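(* Let $P$ (the underlying dynamics) and $\widehat{P}$ (the estimated dynamics) be two transition dynamics on the same state space $\mathcal{S}$ and action space $\mathcal{A}$, with the same initial state distribution $p_0$ and the same reward function $r$, and assume $r(s,a)\in[0,R_{\max}]$ for all $(s,a)$. Let $\gamma,\hat{\gamma}\in[0,1)$ with $\hat{\gamma}\le\gamma$ ($\gamma$ is the discount factor used for evaluation, $\hat{\gamma}$ the one used for training). Let $\pi$ (the imitated policy) and $\pi^E$ (the expert policy) be policies. Then $$\left| J_{P,\gamma}(\pi)-J_{P,\gamma}(\pi^E)\right| \le \frac{2R_{\max}}{1-\hat{\gamma}}\left(\frac{\gamma-\hat{\gamma}}{1-\gamma}+\frac{\hat{\gamma}\,\epsilon_P}{1-\hat{\gamma}}+\frac{\epsilon_\pi}{1-\hat{\gamma}}\right),$$ where $$\epsilon_P=\mathbb{E}_{(s,a)\sim d^{\pi}_{\widehat{P},\hat{\gamma}}}\left[D_{TV}\big(\widehat{P}(\cdot\mid s,a)\,\Vert\, P(\cdot\mid s,a)\big)\right]+\mathbb{E}_{(s,a)\sim d^{\pi^E}_{\widehat{P},\hat{\gamma}}}\left[D_{TV}\big(\widehat{P}(\cdot\mid s,a)\,\Vert\, P(\cdot\mid s,a)\big)\right]$$ and $$\epsilon_\pi=\mathbb{E}_{(s,a)\sim d^{\pi}_{\widehat{P},\hat{\gamma}}}\left[D_{TV}\big(\pi(\cdot\mid s)\,\Vert\,\pi^E(\cdot\mid s)\big)\right].$$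
   Context: $\mathcal{S}$ and $\mathcal{A}$ are (finite or countable) discrete state and action spaces. A transition dynamics $P$ assigns to each $(s,a)\in\mathcal{S}\times\mathcal{A}$ a probability distribution $P(\cdot\mid s,a)$ on $\mathcal{S}$; $p_0$ is a probability distribution on $\mathcal{S}$; a policy $\pi$ assigns to each $s\in\mathcal{S}$ a probability distribution $\pi(\cdot\mid s)$ on $\mathcal{A}$; $r:\mathcal{S}\times\mathcal{A}\to\mathbb{R}$ is the reward function. Given $p_0,P,\pi$, the process is $s_0\sim p_0$, $a_t\sim\pi(\cdot\mid s_t)$, $s_{t+1}\sim P(\cdot\mid s_t,a_t)$ for all $t\ge 0$. For a discount factor $\gamma\in[0,1)$, the expected total discounted reward of $\pi$ under $P$ is $$J_{P,\gamma}(\pi)=\mathbb{E}\Big[\sum_{t=0}^{\infty}\gamma^t r(s_t,a_t)\,\Big|\,p_0,P,\pi\Big].$$ The (normalized) state-action visitation distribution is $$d^{\pi}_{P,\gamma}(s,a)=(1-\gamma)\sum_{t=0}^{\infty}\gamma^t\Pr(s_t=s,a_t=a\mid p_0,P,\pi).$$ For probability distributions $\mu,\nu$ on a countable set $X$, $D_{TV}(\mu\Vert\nu)=\frac12\sum_{x\in X}|\mu(x)-\nu(x)|$. *)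

theory Defs
  imports "HOL-Probability.Probability"
begin

text \<open>
  The process is realised on the canonical path space: a trajectory is a function
  \<open>\<omega> :: nat \<Rightarrow> 's \<times> 'a\<close> with \<open>\<omega> t = (s\<^sub>t, a\<^sub>t)\<close>.
  Its law is obtained from the one-step kernels below by the Ionescu-Tulcea theorem.
\<close>

definition mdp_step ::
  "'s pmf \<Rightarrow> ('s \<Rightarrow> 'a \<Rightarrow> 's pmf) \<Rightarrow> ('s \<Rightarrow> 'a pmf) \<Rightarrow> nat \<Rightarrow> (nat \<Rightarrow> 's \<times> 'a) \<Rightarrow> ('s \<times> 'a) pmf"
where
  "mdp_step p0 P \<pi> t \<omega> =
     do {
       s \<leftarrow> (case t of 0 \<Rightarrow> p0 | Suc k \<Rightarrow> P (fst (\<omega> k)) (snd (\<omega> k)));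
       a \<leftarrow> \<pi> s;
       return_pmf (s, a)
     }"

lemma Ionescu_Tulcea_mdp:
  fixes p0 :: "'s pmf" and P :: "'s \<Rightarrow> 'a \<Rightarrow> 's pmf" and \<pi> :: "'s \<Rightarrow> 'a pmf"
  shows "Ionescu_Tulcea (\<lambda>t \<omega>. measure_pmf (mdp_step p0 P \<pi> t \<omega>)) (\<lambda>_. count_space UNIV)"
proof
  fix t :: nat
  let ?M = "PiM {0..<t} (\<lambda>_. count_space UNIV) :: (nat \<Rightarrow> 's \<times> 'a) measure"
  let ?S = "subprob_algebra (count_space UNIV) :: ('s \<times> 'a) measure measure"
  show "(\<lambda>\<omega>. measure_pmf (mdp_step p0 P \<pi> t \<omega>)) \<in> measurable ?M ?S"
  proof (cases t)
    case 0
    then show ?thesis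
      by (simp add: mdp_step_def measure_pmf_in_subprob_algebra)
  next
    case (Suc k)
    define g where "g = (\<lambda>x::'s \<times> 'a.
      measure_pmf (bind_pmf (P (fst x) (snd x)) (\<lambda>s. bind_pmf (\<pi> s) (\<lambda>a. return_pmf (s, a)))))"
    have "(\<lambda>\<omega>. \<omega> k) \<in> measurable ?M (count_space UNIV)"
      by (rule measurable_component_singleton) (simp add: Suc)
    moreover have "g \<in> measurable (count_space UNIV) ?S"
      by (auto simp: g_def measure_pmf_in_subprob_algebra)
    ultimately have "(\<lambda>\<omega>. g (\<omega> k)) \<in> measurable ?M ?S"
      by (rule measurable_compose)
    then show ?thesis
      by (simp add: Suc mdp_step_def g_def)
  qed
qed

definition trajectory ::
  "'s pmf \<Rightarrow> ('s \<Rightarrow> 'a \<Rightarrow> 's pmf) \<Rightarrow> ('s \<Rightarrow> 'a pmf) \<Rightarrow> (nat \<Rightarrow> 's \<times> 'a) measure"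
where
  "trajectory p0 P \<pi> =
     projective_family.lim UNIV
       (Ionescu_Tulcea.CI (\<lambda>t \<omega>. measure_pmf (mdp_step p0 P \<pi> t \<omega>)) (\<lambda>_. count_space UNIV))
       (\<lambda>_. count_space UNIV)"

lemma sets_trajectory: "sets (trajectory p0 P \<pi>) = sets (PiM UNIV (\<lambda>_. count_space UNIV))"
proof -
  interpret Ionescu_Tulcea "\<lambda>t \<omega>. measure_pmf (mdp_step p0 P \<pi> t \<omega>)" "\<lambda>_. count_space UNIV"
    by (rule Ionescu_Tulcea_mdp)
  show ?thesis
    unfolding trajectory_def by (rule PF.sets_lim)
qed

lemma prob_space_trajectory: "prob_space (trajectory p0 P \<pi>)"
proof -
  interpret Ionescu_Tulcea "\<lambda>t \<omega>. measure_pmf (mdp_step p0 P \<pi> t \<omega>)" "\<lambda>_. count_space UNIV"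
    by (rule Ionescu_Tulcea_mdp)
  have "prob_space (distr PF.lim (PiM {} (\<lambda>_. count_space UNIV)) (\<lambda>\<omega>. restrict \<omega> {}))"
    by (subst distr_lim) (auto intro: PF.prob_space_P)
  then show ?thesis
    unfolding trajectory_def
    by (rule prob_space_distrD[rotated])
       (auto simp: measurable_cong_sets[OF PF.sets_lim refl] intro!: measurable_restrict)
qed

definition expected_return ::
  "'s pmf \<Rightarrow> ('s \<Rightarrow> 'a \<Rightarrow> real) \<Rightarrow> ('s \<Rightarrow> 'a \<Rightarrow> 's pmf) \<Rightarrow> real \<Rightarrow> ('s \<Rightarrow> 'a pmf) \<Rightarrow> real"
where
  "expected_return p0 r P \<gamma> \<pi> =
     (\<integral>\<omega>. (\<Sum>t. \<gamma> ^ t * r (fst (\<omega> t)) (snd (\<omega> t))) \<partial>trajectory p0 P \<pi>)"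

definition visitation ::
  "'s pmf \<Rightarrow> ('s \<Rightarrow> 'a \<Rightarrow> 's pmf) \<Rightarrow> real \<Rightarrow> ('s \<Rightarrow> 'a pmf) \<Rightarrow> 's \<Rightarrow> 'a \<Rightarrow> real"
where
  "visitation p0 P \<gamma> \<pi> s a =
     (1 - \<gamma>) * (\<Sum>t. \<gamma> ^ t * \<P>(\<omega> in trajectory p0 P \<pi>. fst (\<omega> t) = s \<and> snd (\<omega> t) = a))"

definition visitation_expectation ::
  "'s pmf \<Rightarrow> ('s \<Rightarrow> 'a \<Rightarrow> 's pmf) \<Rightarrow> real \<Rightarrow> ('s \<Rightarrow> 'a pmf) \<Rightarrow> ('s \<Rightarrow> 'a \<Rightarrow> real) \<Rightarrow> real"
where
  "visitation_expectation p0 P \<gamma> \<pi> f = (\<Sum>\<^sub>\<infinity>(s, a)\<in>UNIV. visitation p0 P \<gamma> \<pi> s a * f s a)"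

definition tv_dist :: "'x pmf \<Rightarrow> 'x pmf \<Rightarrow> real" where
  "tv_dist \<mu> \<nu> = 1 / 2 * (\<Sum>\<^sub>\<infinity>x\<in>UNIV. \<bar>pmf \<mu> x - pmf \<nu> x\<bar>)"

end

theory Submission
  imports Defs
begin

no_notation Infinite_Sum.abs_summable_on (infixr "abs'_summable'_on" 46)

text \<open>
  Passing from \<open>\<gamma>\<close> to \<open>\<gamma>hat\<close> changes each return by at most the difference of two geometric series.
  At the fixed discount \<open>\<gamma>hat\<close>, compare \<open>(P, \<pi>)\<close> with \<open>(P, \<pi>E)\<close> through \<open>(Phat, \<pi>)\<close> and
  \<open>(Phat, \<pi>E)\<close>. Each comparison uses that the visitation distribution is the fixed point of
  \<open>d \<mapsto> (1 - \<gamma>) p0 \<pi> + \<gamma> d P \<pi>\<close>: if \<open>S\<close> is the largest difference of expectations of a function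
  bounded by \<open>B\<close> under two such fixed points \<open>d\<close>, \<open>d'\<close>, then \<open>S \<le> 2 B \<delta> + \<gamma> S\<close>, where \<open>\<delta>\<close> is the
  one-step total variation error averaged over \<open>d\<close>, whence \<open>S \<le> 2 B \<delta> / (1 - \<gamma>)\<close>.
\<close>

section \<open>Expectations and total variation of probability mass functions\<close>

lemma integrable_measure_pmf_bounded:
  fixes f :: "'x \<Rightarrow> real"
  assumes "\<And>x. \<bar>f x\<bar> \<le> B"
  shows "integrable (measure_pmf M) f"
  by (rule measure_pmf.integrable_const_bound[of _ B]) (use assms in auto)

lemma abs_integral_measure_pmf_le:
  fixes f :: "'x \<Rightarrow> real"
  assumes "\<And>x. \<bar>f x\<bar> \<le> B"
  shows "\<bar>measure_pmf.expectation M f\<bar> \<le> B"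
proof -
  have "measure_pmf.expectation M f \<le> B"
    by (rule measure_pmf.integral_le_const)
       (use assms integrable_measure_pmf_bounded[of f B M] in \<open>auto simp: abs_le_iff\<close>)
  moreover have "measure_pmf.expectation M f \<ge> - B"
    by (rule measure_pmf.integral_ge_const)
       (use assms integrable_measure_pmf_bounded[of f B M] in \<open>auto simp: abs_le_iff minus_le_iff\<close>)
  ultimately show ?thesis
    by simp
qed

text \<open>For nonnegative integrands, integration against \<open>bind_pmf\<close> is iterated
  integration in \<open>ennreal\<close>. Adding the constant \<open>B\<close> makes \<open>f\<close>
  nonnegative and keeps it bounded; the constant is then subtracted from both sides.\<close>

lemma integral_bind_pmf_bounded:
  fixes f :: "'y \<Rightarrow> real"
  assumes "\<And>y. \<bar>f y\<bar> \<le> B"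
  shows "measure_pmf.expectation (bind_pmf M N) f
    = measure_pmf.expectation M (\<lambda>x. measure_pmf.expectation (N x) f)"
proof -
  define g where "g = (\<lambda>y. f y + B)"
  have g: "0 \<le> g y" "\<bar>g y\<bar> \<le> 2 * B" for y
    using assms[of y] by (auto simp: g_def)
  have int_g: "integrable (measure_pmf L) g" for L
    using g(2) by (rule integrable_measure_pmf_bounded)
  have E_g: "measure_pmf.expectation L g = measure_pmf.expectation L f + B" for L
    unfolding g_def using integrable_measure_pmf_bounded[of f B L, OF assms]
    by simp
  have nn: "ennreal (measure_pmf.expectation L g) = (\<integral>\<^sup>+y. g y \<partial>L)" for L
    using g int_g by (simp add: nn_integral_eq_integral)
  have "ennreal (measure_pmf.expectation (bind_pmf M N) g)
      = (\<integral>\<^sup>+x. ennreal (measure_pmf.expectation (N x) g) \<partial>M)"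
    by (simp add: nn)
  also have "\<dots> = ennreal (measure_pmf.expectation M (\<lambda>x. measure_pmf.expectation (N x) g))"
    using g abs_integral_measure_pmf_le[of g "2 * B"]
    by (intro nn_integral_eq_integral integrable_measure_pmf_bounded[of _ "2 * B"])
       (auto intro: integral_nonneg)
  finally have "measure_pmf.expectation (bind_pmf M N) g
      = measure_pmf.expectation M (\<lambda>x. measure_pmf.expectation (N x) g)"
    using g by (simp add: integral_nonneg)
  moreover have "integrable (measure_pmf M) (\<lambda>x. measure_pmf.expectation (N x) f)"
    by (rule integrable_measure_pmf_bounded) (rule abs_integral_measure_pmf_le[OF assms])
  ultimately show ?thesis
    by (simp add: E_g)
qed

lemma integrable_pmf_mult_bounded:
  fixes f :: "'x \<Rightarrow> real"
  assumes "\<And>x. \<bar>f x\<bar> \<le> B"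
  shows "integrable (count_space UNIV) (\<lambda>x. pmf M x * f x)"
  using integrable_measure_pmf_bounded[of f B M, OF assms]
  unfolding measure_pmf_eq_density by (subst (asm) integrable_density) auto

lemma expectation_eq_integral_count_space:
  fixes f :: "'x \<Rightarrow> real"
  shows "measure_pmf.expectation M f = (\<integral>x. pmf M x * f x \<partial>count_space UNIV)"
  unfolding measure_pmf_eq_density by (subst integral_density) simp_all

text \<open>Links the unordered sums of the definitions to Bochner integrals. In the proof
  \<open>abs_summable_on\<close> is integrability for the counting measure, and for such families
  both notions of sum agree.\<close>

lemma infsum_pmf_mult_bounded:
  fixes f :: "'x \<Rightarrow> real"
  assumes "\<And>x. \<bar>f x\<bar> \<le> B"
  shows "(\<Sum>\<^sub>\<infinity>x. pmf M x * f x) = measure_pmf.expectation M f"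
proof -
  have "(\<lambda>x. pmf M x * f x) abs_summable_on UNIV"
    unfolding Infinite_Set_Sum.abs_summable_on_def
    using assms by (rule integrable_pmf_mult_bounded)
  then have "(\<Sum>\<^sub>\<infinity>x. pmf M x * f x) = infsetsum (\<lambda>x. pmf M x * f x) UNIV"
    by (rule infsetsum_infsum[symmetric])
  then show ?thesis
    by (simp add: infsetsum_def expectation_eq_integral_count_space)
qed

section \<open>Total variation distance and its effect on bounded test functions\<close>

lemma tv_dist_eq_integral:
  "tv_dist \<mu> \<nu> = 1 / 2 * (\<integral>x. \<bar>pmf \<mu> x - pmf \<nu> x\<bar> \<partial>count_space UNIV)"
proof -
  have "(\<lambda>x. \<bar>pmf \<mu> x - pmf \<nu> x\<bar>) abs_summable_on UNIV"
    unfolding Infinite_Set_Sum.abs_summable_on_def by (auto simp: integrable_pmf)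
  then show ?thesis
    unfolding tv_dist_def by (simp add: infsetsum_infsum[symmetric] infsetsum_def)
qed

lemma tv_dist_nonneg: "0 \<le> tv_dist \<mu> \<nu>"
  by (simp add: tv_dist_eq_integral integral_nonneg)

lemma tv_dist_self [simp]: "tv_dist \<mu> \<mu> = 0"
  by (simp add: tv_dist_eq_integral)

lemma tv_dist_le_1: "tv_dist \<mu> \<nu> \<le> 1"
proof -
  have "(\<integral>x. \<bar>pmf \<mu> x - pmf \<nu> x\<bar> \<partial>count_space UNIV)
      \<le> (\<integral>x. pmf \<mu> x + pmf \<nu> x \<partial>count_space UNIV)"
    by (intro integral_mono) (auto simp: integrable_pmf abs_le_iff add_increasing add_increasing2)
  also have "\<dots> = 2"
    by (simp add: integrable_pmf integral_pmf)
  finally show ?thesis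
    by (simp add: tv_dist_eq_integral)
qed

lemma abs_tv_dist_le_1: "\<bar>tv_dist \<mu> \<nu>\<bar> \<le> 1"
  using tv_dist_nonneg[of \<mu> \<nu>] tv_dist_le_1[of \<mu> \<nu>] by simp

text \<open>Both expectations become one integral against the difference of the mass functions,
  where \<open>f\<close> is bounded pointwise by \<open>B\<close>; the factor 2 cancels the 1/2
  inside \<open>tv_dist\<close>.\<close>

lemma integral_diff_le_tv_dist:
  fixes f :: "'x \<Rightarrow> real"
  assumes f: "\<And>x. \<bar>f x\<bar> \<le> B"
  shows "\<bar>measure_pmf.expectation \<mu> f - measure_pmf.expectation \<nu> f\<bar> \<le> 2 * B * tv_dist \<mu> \<nu>"
proof -
  let ?C = "count_space UNIV :: 'x measure"
  have int: "integrable ?C (\<lambda>x. pmf M x * f x)" for M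
    using f by (rule integrable_pmf_mult_bounded)
  have "measure_pmf.expectation \<mu> f - measure_pmf.expectation \<nu> f
      = (\<integral>x. (pmf \<mu> x - pmf \<nu> x) * f x \<partial>?C)"
    unfolding expectation_eq_integral_count_space by (simp add: int left_diff_distrib)
  also have "\<bar>\<dots>\<bar> \<le> (\<integral>x. \<bar>(pmf \<mu> x - pmf \<nu> x) * f x\<bar> \<partial>?C)"
    by (rule integral_abs_bound)
  also have "\<dots> \<le> (\<integral>x. B * \<bar>pmf \<mu> x - pmf \<nu> x\<bar> \<partial>?C)"
  proof (rule integral_mono)
    show "integrable ?C (\<lambda>x. \<bar>(pmf \<mu> x - pmf \<nu> x) * f x\<bar>)"
      using int by (simp add: left_diff_distrib)
    show "integrable ?C (\<lambda>x. B * \<bar>pmf \<mu> x - pmf \<nu> x\<bar>)"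
      by (simp add: integrable_pmf)
    show "\<bar>(pmf \<mu> x - pmf \<nu> x) * f x\<bar> \<le> B * \<bar>pmf \<mu> x - pmf \<nu> x\<bar>" for x
      using mult_right_mono[OF f[of x], of "\<bar>pmf \<mu> x - pmf \<nu> x\<bar>"]
      by (simp add: abs_mult mult.commute)
  qed
  also have "\<dots> = 2 * B * tv_dist \<mu> \<nu>"
    by (simp add: tv_dist_eq_integral)
  finally show ?thesis .
qed

text \<open>The geometric law with success probability 1 - \<gamma> has mass (1 - \<gamma>)
  \<gamma>^t at t. A discounted series is thus, up to normalisation, an expectation at a random
  geometric time.\<close>

lemma sums_geometric_pmf_expectation:
  fixes h :: "nat \<Rightarrow> real"
  assumes \<gamma>: "0 \<le> \<gamma>" "\<gamma> < 1" and h: "\<And>t. \<bar>h t\<bar> \<le> B"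
  shows "(\<lambda>t. \<gamma> ^ t * h t) sums (measure_pmf.expectation (geometric_pmf (1 - \<gamma>)) h / (1 - \<gamma>))"
proof -
  have p: "1 - \<gamma> \<in> {0<..1}"
    using \<gamma> by simp
  have "(\<lambda>t. pmf (geometric_pmf (1 - \<gamma>)) t * h t) sums
      (\<integral>t. pmf (geometric_pmf (1 - \<gamma>)) t * h t \<partial>count_space UNIV)"
    using h by (intro sums_integral_count_space_nat integrable_pmf_mult_bounded)
  also have "(\<integral>t. pmf (geometric_pmf (1 - \<gamma>)) t * h t \<partial>count_space UNIV)
      = measure_pmf.expectation (geometric_pmf (1 - \<gamma>)) h"
    by (rule expectation_eq_integral_count_space[symmetric])
  finally have "(\<lambda>t. (1 - \<gamma>) * (\<gamma> ^ t * h t)) sums measure_pmf.expectation (geometric_pmf (1 - \<gamma>)) h"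
    using p by (simp add: mult_ac)
  from sums_divide[OF this, of "1 - \<gamma>"] show ?thesis
    using \<gamma> by simp
qed

section \<open>One-step marginals and the discounted occupancy measure\<close>

definition act :: "('s \<Rightarrow> 'a pmf) \<Rightarrow> 's \<Rightarrow> ('s \<times> 'a) pmf" where
  "act \<pi> s = map_pmf (Pair s) (\<pi> s)"

text \<open>Built by the Markov recursion alone, without the path space;
  \<open>distr_trajectory\<close> identifies it with the law of coordinate t of a
  trajectory.\<close>

primrec state_action_law ::
  "'s pmf \<Rightarrow> ('s \<Rightarrow> 'a \<Rightarrow> 's pmf) \<Rightarrow> ('s \<Rightarrow> 'a pmf) \<Rightarrow> nat \<Rightarrow> ('s \<times> 'a) pmf" where
  "state_action_law p0 P \<pi> 0 = bind_pmf p0 (act \<pi>)"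
| "state_action_law p0 P \<pi> (Suc t) =
     bind_pmf (bind_pmf (state_action_law p0 P \<pi> t) (\<lambda>x. P (fst x) (snd x))) (act \<pi>)"

text \<open>The law of the state-action pair at an independent geometric time. Its mass function is
  \<open>visitation\<close>, and being a pmf it can be handled by conditioning on the first step of
  the geometric time.\<close>

definition occupancy ::
  "'s pmf \<Rightarrow> ('s \<Rightarrow> 'a \<Rightarrow> 's pmf) \<Rightarrow> real \<Rightarrow> ('s \<Rightarrow> 'a pmf) \<Rightarrow> ('s \<times> 'a) pmf" where
  "occupancy p0 P \<gamma> \<pi> = bind_pmf (geometric_pmf (1 - \<gamma>)) (state_action_law p0 P \<pi>)"

text \<open>The state marginal of \<open>occupancy\<close>, in restart form: with probability 1 -
  \<gamma> draw from \<open>p0\<close>, otherwise make one transition from a pair drawn from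
  \<open>occupancy\<close>.\<close>

definition state_occupancy ::
  "'s pmf \<Rightarrow> ('s \<Rightarrow> 'a \<Rightarrow> 's pmf) \<Rightarrow> real \<Rightarrow> ('s \<Rightarrow> 'a pmf) \<Rightarrow> 's pmf" where
  "state_occupancy p0 P \<gamma> \<pi> = bind_pmf (bernoulli_pmf (1 - \<gamma>))
     (\<lambda>b. if b then p0 else bind_pmf (occupancy p0 P \<gamma> \<pi>) (\<lambda>x. P (fst x) (snd x)))"

section \<open>One-time marginals of the trajectory measure\<close>

lemma mdp_step_eq:
  "mdp_step p0 P \<pi> t \<omega> = bind_pmf (case t of 0 \<Rightarrow> p0 | Suc k \<Rightarrow> P (fst (\<omega> k)) (snd (\<omega> k))) (act \<pi>)"
  unfolding mdp_step_def act_def map_pmf_def by simp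

text \<open>The kernel at a positive time reads only the preceding pair. Integrating out the last
  coordinate of a finite history therefore leaves a function of the coordinate before it, and
  induction on time reproduces the recursion of \<open>state_action_law\<close>.\<close>

lemma distr_trajectory:
  "distr (trajectory p0 P \<pi>) (count_space UNIV) (\<lambda>\<omega>. \<omega> t) = measure_pmf (state_action_law p0 P \<pi> t)"
proof -
  interpret Ionescu_Tulcea "\<lambda>t \<omega>. measure_pmf (mdp_step p0 P \<pi> t \<omega>)"
    "\<lambda>_. count_space UNIV :: ('a \<times> 'b) measure"
    by (rule Ionescu_Tulcea_mdp)
  let ?S = "\<lambda>J. PiM J (\<lambda>_::nat. count_space UNIV :: ('a \<times> 'b) measure)"
  \<comment> \<open>The empty history: the only point of the product over the empty index
    set.\<close>
  let ?u = "\<lambda>_::nat. undefined :: 'a \<times> 'b"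
  have u: "?u \<in> space (?S {0..<0})"
    by (simp add: space_PiM)
  have sets_C0: "sets (C 0 n ?u) = sets (?S {0..<n})" for n
    using sets_C[OF u, of n] by simp
  have marginal: "(\<integral>\<^sup>+\<omega>. f (\<omega> t) \<partial>C 0 (Suc t) ?u) = (\<integral>\<^sup>+x. f x \<partial>state_action_law p0 P \<pi> t)"
    for f :: "'a \<times> 'b \<Rightarrow> ennreal" and t
  proof (induction t arbitrary: f)
    \<comment> \<open>\<open>C 0 (Suc t)\<close> is \<open>C 0 t\<close> bound to
      \<open>eP t\<close>, which extends a history by one coordinate; \<open>f\<close> sees only
      that new coordinate.\<close>
    have step: "(\<integral>\<^sup>+\<omega>. f (\<omega> t) \<partial>C 0 (Suc t) ?u)
        = (\<integral>\<^sup>+\<omega>. (\<integral>\<^sup>+x. f x \<partial>mdp_step p0 P \<pi> t \<omega>) \<partial>C 0 t ?u)" for t and f :: "'a \<times> 'b \<Rightarrow> ennreal"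
    proof -
      have meas: "(\<lambda>\<omega>. f (\<omega> t)) \<in> borel_measurable (?S {0..<Suc t})"
        by (rule measurable_compose[OF measurable_component_singleton]) auto
      have meC: "eP t \<in> measurable (C 0 t ?u) (subprob_algebra (?S {0..<Suc t}))"
        using measurable_eP[of t] measurable_cong_sets[OF sets_C0 refl] by blast
      have "(\<integral>\<^sup>+\<omega>. f (\<omega> t) \<partial>C 0 (Suc t) ?u)
          = (\<integral>\<^sup>+\<omega>. (\<integral>\<^sup>+\<omega>'. f (\<omega>' t) \<partial>eP t \<omega>) \<partial>C 0 t ?u)"
        using nn_integral_bind[OF meas meC] by simp
      also have "\<dots> = (\<integral>\<^sup>+\<omega>. (\<integral>\<^sup>+x. f x \<partial>mdp_step p0 P \<pi> t \<omega>) \<partial>C 0 t ?u)"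
        using space_C[OF u, of t] by (intro nn_integral_cong) (simp add: nn_integral_eP meas)
      finally show ?thesis .
    qed
    {
      case 0
      \<comment> \<open>At time 0 the kernel ignores the history, so the inner integral is constant
        and \<open>C 0 0 ?u\<close> has total mass 1.\<close>
      show ?case
        unfolding step by (subst nn_integral_cong[where v="\<lambda>_. \<integral>\<^sup>+x. f x \<partial>state_action_law p0 P \<pi> 0"])
          (use prob_space.emeasure_space_1[OF prob_space_C[OF u, of 0]] in \<open>auto simp: mdp_step_eq\<close>)
    next
      case (Suc t)
      \<comment> \<open>Averaging \<open>f\<close> over the next step gives a function of the
        current pair, to which the induction hypothesis applies because it is stated for every test
        function.\<close>
      let ?g = "\<lambda>x. \<integral>\<^sup>+y. f y \<partial>bind_pmf (P (fst x) (snd x)) (act \<pi>)"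
      have "(\<integral>\<^sup>+\<omega>. f (\<omega> (Suc t)) \<partial>C 0 (Suc (Suc t)) ?u) = (\<integral>\<^sup>+\<omega>. ?g (\<omega> t) \<partial>C 0 (Suc t) ?u)"
        unfolding step by (intro nn_integral_cong) (simp add: mdp_step_eq)
      also have "\<dots> = (\<integral>\<^sup>+x. ?g x \<partial>state_action_law p0 P \<pi> t)"
        by (rule Suc.IH)
      finally show ?case
        by simp
    }
  qed
  \<comment> \<open>On an initial segment of times the cylinder embedding in
    \<open>emeasure_CI\<close> is the identity.\<close>
  have CI_eq: "CI {0..<n} = C 0 n ?u" for n
  proof (rule measure_eqI)
    show "sets (CI {0..<n}) = sets (C 0 n ?u)"
      by (simp add: CI_def sets_C0)
    fix X assume "X \<in> sets (CI {0..<n})"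
    then have X: "X \<in> sets (?S {0..<n})"
      by (simp add: CI_def)
    then show "emeasure (CI {0..<n}) X = emeasure (C 0 n ?u) X"
      using emeasure_CI[OF order_refl X] prod_emb_id[of X] sets.sets_into_space[OF X]
      by (simp add: space_PiM)
  qed
  show ?thesis
  proof (rule measure_eqI)
    show "sets (distr (trajectory p0 P \<pi>) (count_space UNIV) (\<lambda>\<omega>. \<omega> t))
        = sets (measure_pmf (state_action_law p0 P \<pi> t))"
      by simp
    fix A :: "('a \<times> 'b) set"
    have restr: "(\<lambda>\<omega>. restrict \<omega> {0..<Suc t}) \<in> measurable PF.lim (?S {0..<Suc t})"
      by (auto simp: measurable_cong_sets[OF PF.sets_lim refl] intro!: measurable_restrict)
    have comp: "(\<lambda>\<omega>. \<omega> t) \<in> measurable (?S {0..<Suc t}) (count_space UNIV)"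
      by (rule measurable_component_singleton) simp
    \<comment> \<open>Coordinate \<open>t\<close> is read off the prefix of length
      \<open>Suc t\<close>, on which the limit measure projects to
      \<open>C 0 (Suc t) ?u\<close>.\<close>
    have "distr PF.lim (count_space UNIV) (\<lambda>\<omega>. \<omega> t)
        = distr (distr PF.lim (?S {0..<Suc t}) (\<lambda>\<omega>. restrict \<omega> {0..<Suc t})) (count_space UNIV) (\<lambda>\<omega>. \<omega> t)"
      by (subst distr_distr[OF comp restr]) (simp add: comp_def)
    also have "\<dots> = distr (C 0 (Suc t) ?u) (count_space UNIV) (\<lambda>\<omega>. \<omega> t)"
      by (simp add: distr_lim CI_eq del: C.simps)
    finally have "emeasure (distr (trajectory p0 P \<pi>) (count_space UNIV) (\<lambda>\<omega>. \<omega> t)) A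
        = (\<integral>\<^sup>+x. indicator A x \<partial>distr (C 0 (Suc t) ?u) (count_space UNIV) (\<lambda>\<omega>. \<omega> t))"
      by (simp add: trajectory_def)
    also have "\<dots> = (\<integral>\<^sup>+\<omega>. indicator A (\<omega> t) \<partial>C 0 (Suc t) ?u)"
      by (rule nn_integral_distr) (subst measurable_cong_sets[OF sets_C0 refl], rule comp, simp)
    also have "\<dots> = emeasure (state_action_law p0 P \<pi> t) A"
      unfolding marginal by simp
    finally show "emeasure (distr (trajectory p0 P \<pi>) (count_space UNIV) (\<lambda>\<omega>. \<omega> t)) A
        = emeasure (state_action_law p0 P \<pi> t) A" .
  qed
qed

lemma measurable_trajectory_component:
  "(\<lambda>\<omega>. \<omega> t) \<in> measurable (trajectory p0 P \<pi>) (count_space UNIV)"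
  using measurable_component_singleton[of t UNIV "\<lambda>_. count_space UNIV"]
  by (simp add: measurable_cong_sets[OF sets_trajectory refl])

lemma integral_trajectory:
  fixes f :: "'s \<times> 'a \<Rightarrow> real"
  shows "(\<integral>\<omega>. f (\<omega> t) \<partial>trajectory p0 P \<pi>) = measure_pmf.expectation (state_action_law p0 P \<pi> t) f"
  unfolding distr_trajectory[symmetric]
  by (rule integral_distr[symmetric, OF measurable_trajectory_component]) simp

lemma prob_trajectory:
  "\<P>(\<omega> in trajectory p0 P \<pi>. fst (\<omega> t) = s \<and> snd (\<omega> t) = a) = pmf (state_action_law p0 P \<pi> t) (s, a)"
proof -
  have "pmf (state_action_law p0 P \<pi> t) (s, a)
      = measure (distr (trajectory p0 P \<pi>) (count_space UNIV) (\<lambda>\<omega>. \<omega> t)) {(s, a)}"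
    by (simp add: distr_trajectory measure_pmf_single)
  also have "\<dots> = measure (trajectory p0 P \<pi>) ((\<lambda>\<omega>. \<omega> t) -` {(s, a)} \<inter> space (trajectory p0 P \<pi>))"
    by (rule measure_distr[OF measurable_trajectory_component]) simp
  also have "(\<lambda>\<omega>. \<omega> t) -` {(s, a)} \<inter> space (trajectory p0 P \<pi>)
      = {\<omega> \<in> space (trajectory p0 P \<pi>). fst (\<omega> t) = s \<and> snd (\<omega> t) = a}"
    by (auto simp: prod_eq_iff)
  finally show ?thesis ..
qed

section \<open>Visitation, return and the fixed-point equation in terms of
  \<open>occupancy\<close>\<close>

lemma visitation_eq_pmf_occupancy:
  assumes \<gamma>: "0 \<le> \<gamma>" "\<gamma> < 1"
  shows "visitation p0 P \<gamma> \<pi> s a = pmf (occupancy p0 P \<gamma> \<pi>) (s, a)"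
proof -
  have "(\<lambda>t. \<gamma> ^ t * pmf (state_action_law p0 P \<pi> t) (s, a)) sums
      (pmf (occupancy p0 P \<gamma> \<pi>) (s, a) / (1 - \<gamma>))"
    unfolding occupancy_def pmf_bind
    by (rule sums_geometric_pmf_expectation[OF \<gamma>, of _ 1]) (simp add: pmf_le_1)
  then show ?thesis
    unfolding visitation_def prob_trajectory using \<gamma> by (simp add: sums_iff)
qed

lemma visitation_expectation_eq:
  assumes \<gamma>: "0 \<le> \<gamma>" "\<gamma> < 1" and f: "\<And>s a. \<bar>f s a\<bar> \<le> B"
  shows "visitation_expectation p0 P \<gamma> \<pi> f
    = measure_pmf.expectation (occupancy p0 P \<gamma> \<pi>) (\<lambda>x. f (fst x) (snd x))"
  unfolding visitation_expectation_def
  using infsum_pmf_mult_bounded[of "\<lambda>x. f (fst x) (snd x)" B "occupancy p0 P \<gamma> \<pi>"] f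
  by (simp add: visitation_eq_pmf_occupancy[OF \<gamma>] split_def)

text \<open>Sum and path integral may be exchanged since the term at time t is dominated by
  \<gamma>^t B, uniformly over trajectories.\<close>

lemma expected_return_sums:
  assumes \<gamma>: "0 \<le> \<gamma>" "\<gamma> < 1" and r: "\<And>s a. \<bar>r s a\<bar> \<le> B"
  shows "(\<lambda>t. \<gamma> ^ t * measure_pmf.expectation (state_action_law p0 P \<pi> t) (\<lambda>x. r (fst x) (snd x)))
    sums expected_return p0 r P \<gamma> \<pi>"
proof -
  interpret prob_space "trajectory p0 P \<pi>"
    by (rule prob_space_trajectory)
  let ?f = "\<lambda>t \<omega>. \<gamma> ^ t * r (fst (\<omega> t)) (snd (\<omega> t))"
  have B: "0 \<le> B"
    using r[of undefined undefined] by linarith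
  have bound: "\<bar>?f t \<omega>\<bar> \<le> \<gamma> ^ t * B" for t \<omega>
    using \<gamma> r by (auto simp: abs_mult intro!: mult_left_mono)
  have sum_B: "summable (\<lambda>t. \<gamma> ^ t * B)"
    using \<gamma> by (intro summable_mult2 summable_geometric) simp
  have meas: "?f t \<in> borel_measurable (trajectory p0 P \<pi>)" for t
    by (rule measurable_compose[OF measurable_trajectory_component]) simp
  have int: "integrable (trajectory p0 P \<pi>) (?f t)" for t
    by (rule integrable_const_bound[of _ "\<gamma> ^ t * B"]) (use bound meas in auto)
  have "(\<lambda>t. \<integral>\<omega>. ?f t \<omega> \<partial>trajectory p0 P \<pi>) sums (\<integral>\<omega>. (\<Sum>t. ?f t \<omega>) \<partial>trajectory p0 P \<pi>)"
  proof (rule sums_integral[OF int])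
    show "AE \<omega> in trajectory p0 P \<pi>. summable (\<lambda>t. norm (?f t \<omega>))"
      using bound by (intro AE_I2 summable_comparison_test'[OF sum_B, of 0]) auto
    have "\<bar>\<integral>\<omega>. norm (?f t \<omega>) \<partial>trajectory p0 P \<pi>\<bar> \<le> \<gamma> ^ t * B" for t
    proof -
      have "(\<integral>\<omega>. norm (?f t \<omega>) \<partial>trajectory p0 P \<pi>) \<le> \<gamma> ^ t * B"
        using int bound by (intro integral_le_const) auto
      then show ?thesis
        by (simp add: integral_nonneg)
    qed
    then show "summable (\<lambda>t. \<integral>\<omega>. norm (?f t \<omega>) \<partial>trajectory p0 P \<pi>)"
      by (intro summable_comparison_test'[OF sum_B, of 0]) auto
  qed
  then show ?thesis
    unfolding expected_return_def
    by (simp add: integral_trajectory[where f="\<lambda>x. r (fst x) (snd x)", symmetric])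
qed

lemma expected_return_eq_occupancy:
  assumes \<gamma>: "0 \<le> \<gamma>" "\<gamma> < 1" and r: "\<And>s a. \<bar>r s a\<bar> \<le> B"
  shows "expected_return p0 r P \<gamma> \<pi>
    = measure_pmf.expectation (occupancy p0 P \<gamma> \<pi>) (\<lambda>x. r (fst x) (snd x)) / (1 - \<gamma>)"
proof -
  have "(\<lambda>t. \<gamma> ^ t * measure_pmf.expectation (state_action_law p0 P \<pi> t) (\<lambda>x. r (fst x) (snd x)))
    sums (measure_pmf.expectation (occupancy p0 P \<gamma> \<pi>) (\<lambda>x. r (fst x) (snd x)) / (1 - \<gamma>))"
    unfolding occupancy_def using r
    by (subst integral_bind_pmf_bounded[of _ B])
       (auto intro!: sums_geometric_pmf_expectation[OF \<gamma>, of _ B] abs_integral_measure_pmf_le)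
  then show ?thesis
    using expected_return_sums[OF \<gamma> r] by (rule sums_unique2[symmetric])
qed

text \<open>A geometric time is 0 with probability 1 - \<gamma> and otherwise the successor of
  another geometric time; the recursion of \<open>state_action_law\<close> turns this into the
  fixed-point equation.\<close>

lemma occupancy_unfold:
  assumes \<gamma>: "0 \<le> \<gamma>" "\<gamma> < 1"
  shows "occupancy p0 P \<gamma> \<pi> = bind_pmf (state_occupancy p0 P \<gamma> \<pi>) (act \<pi>)"
proof -
  have p: "1 - \<gamma> \<in> {0<..1}"
    using \<gamma> by simp
  have "occupancy p0 P \<gamma> \<pi> = bind_pmf (bernoulli_pmf (1 - \<gamma>))
      (\<lambda>b. bind_pmf (if b then return_pmf 0 else map_pmf Suc (geometric_pmf (1 - \<gamma>))) (state_action_law p0 P \<pi>))"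
    unfolding occupancy_def by (subst geometric_bind_pmf_unfold[OF p]) (simp add: bind_assoc_pmf)
  also have "\<dots> = bind_pmf (state_occupancy p0 P \<gamma> \<pi>) (act \<pi>)"
    unfolding state_occupancy_def occupancy_def bind_assoc_pmf
    by (intro bind_pmf_cong refl) (auto simp: bind_return_pmf bind_map_pmf bind_assoc_pmf)
  finally show ?thesis .
qed

lemma occupancy_expectation:
  fixes f :: "'s \<times> 'a \<Rightarrow> real"
  assumes \<gamma>: "0 \<le> \<gamma>" "\<gamma> < 1" and f: "\<And>x. \<bar>f x\<bar> \<le> B"
  shows "measure_pmf.expectation (occupancy p0 P \<gamma> \<pi>) f
    = measure_pmf.expectation (state_occupancy p0 P \<gamma> \<pi>) (\<lambda>s. measure_pmf.expectation (act \<pi> s) f)"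
  by (subst occupancy_unfold[OF \<gamma>]) (rule integral_bind_pmf_bounded[OF f])

text \<open>The dynamics half of the fixed-point equation; \<open>occupancy_expectation\<close> is
  the policy half. Keeping them apart lets the two model errors be bounded separately.\<close>

lemma state_occupancy_expectation:
  fixes g :: "'s \<Rightarrow> real"
  assumes \<gamma>: "0 \<le> \<gamma>" "\<gamma> < 1" and g: "\<And>s. \<bar>g s\<bar> \<le> B"
  shows "measure_pmf.expectation (state_occupancy p0 P \<gamma> \<pi>) g
    = (1 - \<gamma>) * measure_pmf.expectation p0 g + \<gamma> * measure_pmf.expectation (occupancy p0 P \<gamma> \<pi>)
        (\<lambda>x. measure_pmf.expectation (P (fst x) (snd x)) g)"
  unfolding state_occupancy_def using \<gamma>
  by (simp add: integral_bind_pmf_bounded[OF g] mult.commute)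

section \<open>Stability of the fixed point under changes of policy and dynamics\<close>

lemma abs_expectation_diff_le:
  fixes f g h :: "'x \<Rightarrow> real"
  assumes f: "\<And>x. \<bar>f x\<bar> \<le> B" and g: "\<And>x. \<bar>g x\<bar> \<le> B" and h: "\<And>x. \<bar>h x\<bar> \<le> D"
    and le: "\<And>x. \<bar>f x - g x\<bar> \<le> h x"
  shows "\<bar>measure_pmf.expectation M f - measure_pmf.expectation M g\<bar> \<le> measure_pmf.expectation M h"
proof -
  have int: "integrable (measure_pmf M) f" "integrable (measure_pmf M) g" "integrable (measure_pmf M) h"
    using f g h by (auto intro: integrable_measure_pmf_bounded)
  then have "\<bar>measure_pmf.expectation M f - measure_pmf.expectation M g\<bar>
      = \<bar>measure_pmf.expectation M (\<lambda>x. f x - g x)\<bar>"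
    by simp
  also have "\<dots> \<le> measure_pmf.expectation M (\<lambda>x. \<bar>f x - g x\<bar>)"
    by (rule integral_abs_bound)
  also have "\<dots> \<le> measure_pmf.expectation M h"
    using int le by (intro integral_mono) auto
  finally show ?thesis .
qed

text \<open>Exchange first the policy and then the dynamics, each time averaging over the first
  process. What remains is the same kind of difference for another test function bounded by
  \<open>B\<close>, damped by \<gamma>.\<close>

lemma occupancy_diff_step:
  fixes f :: "'s \<times> 'a \<Rightarrow> real"
  assumes \<gamma>: "0 \<le> \<gamma>" "\<gamma> < 1" and f: "\<And>x. \<bar>f x\<bar> \<le> B"
    and S: "\<And>h :: 's \<times> 'a \<Rightarrow> real. (\<And>x. \<bar>h x\<bar> \<le> B) \<Longrightarrow>
      \<bar>measure_pmf.expectation (occupancy p0 P \<gamma> \<pi>) h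
        - measure_pmf.expectation (occupancy p0 P' \<gamma> \<pi>') h\<bar> \<le> S"
  shows "\<bar>measure_pmf.expectation (occupancy p0 P \<gamma> \<pi>) f
      - measure_pmf.expectation (occupancy p0 P' \<gamma> \<pi>') f\<bar>
    \<le> 2 * B * (measure_pmf.expectation (occupancy p0 P \<gamma> \<pi>) (\<lambda>x. tv_dist (\<pi> (fst x)) (\<pi>' (fst x)))
        + \<gamma> * measure_pmf.expectation (occupancy p0 P \<gamma> \<pi>)
            (\<lambda>x. tv_dist (P (fst x) (snd x)) (P' (fst x) (snd x)))) + \<gamma> * S"
proof -
  let ?d = "occupancy p0 P \<gamma> \<pi>" and ?d' = "occupancy p0 P' \<gamma> \<pi>'"
  let ?q = "state_occupancy p0 P \<gamma> \<pi>" and ?q' = "state_occupancy p0 P' \<gamma> \<pi>'"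
  have B: "0 \<le> B"
    using f[of undefined] by linarith
  have bnd: "\<bar>2 * B * tv_dist \<mu> \<nu>\<bar> \<le> 2 * B" for \<mu> \<nu> :: "'y pmf"
    using B abs_tv_dist_le_1[of \<mu> \<nu>] by (simp add: abs_mult mult_left_le)
  \<comment> \<open>\<open>g\<close> pulls \<open>f\<close> back through the second policy, and
    \<open>h\<close> below pulls \<open>g\<close> back through the second dynamics; averaging
    preserves the bound \<open>B\<close>.\<close>
  define g where "g s = measure_pmf.expectation (act \<pi>' s) f" for s
  have g: "\<bar>g s\<bar> \<le> B" for s
    unfolding g_def using f by (rule abs_integral_measure_pmf_le)
  define h where "h x = measure_pmf.expectation (P' (fst x) (snd x)) g" for x :: "'s \<times> 'a"
  have h: "\<bar>h x\<bar> \<le> B" for x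
    unfolding h_def using g by (rule abs_integral_measure_pmf_le)
  have "\<bar>measure_pmf.expectation ?d f - measure_pmf.expectation ?q g\<bar>
      \<le> measure_pmf.expectation ?q (\<lambda>s. 2 * B * tv_dist (\<pi> s) (\<pi>' s))"
    unfolding occupancy_expectation[OF \<gamma> f]
  proof (rule abs_expectation_diff_le[OF abs_integral_measure_pmf_le[OF f] g bnd])
    show "\<bar>measure_pmf.expectation (act \<pi> s) f - g s\<bar> \<le> 2 * B * tv_dist (\<pi> s) (\<pi>' s)" for s
      unfolding g_def act_def integral_map_pmf by (rule integral_diff_le_tv_dist) (rule f)
  qed
  \<comment> \<open>The integrand depends on the state only, and \<open>act\<close> leaves the state
    unchanged.\<close>
  also have "\<dots> = 2 * B * measure_pmf.expectation ?d (\<lambda>x. tv_dist (\<pi> (fst x)) (\<pi>' (fst x)))"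
    by (subst occupancy_expectation[OF \<gamma> abs_tv_dist_le_1]) (simp add: act_def)
  finally have policy: "\<bar>measure_pmf.expectation ?d f - measure_pmf.expectation ?q g\<bar>
      \<le> 2 * B * measure_pmf.expectation ?d (\<lambda>x. tv_dist (\<pi> (fst x)) (\<pi>' (fst x)))" .
  let ?k = "\<lambda>x. measure_pmf.expectation (P (fst x) (snd x)) g"
  have "\<bar>measure_pmf.expectation ?d ?k - measure_pmf.expectation ?d h\<bar>
      \<le> measure_pmf.expectation ?d (\<lambda>x. 2 * B * tv_dist (P (fst x) (snd x)) (P' (fst x) (snd x)))"
    unfolding h_def
    by (rule abs_expectation_diff_le[OF abs_integral_measure_pmf_le[OF g] abs_integral_measure_pmf_le[OF g] bnd])
       (rule integral_diff_le_tv_dist[OF g])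
  then have "\<bar>measure_pmf.expectation ?d ?k - measure_pmf.expectation ?d' h\<bar>
      \<le> 2 * B * measure_pmf.expectation ?d (\<lambda>x. tv_dist (P (fst x) (snd x)) (P' (fst x) (snd x))) + S"
    using S[of h, OF h] by (simp add: abs_le_iff)
  then have "\<gamma> * \<bar>measure_pmf.expectation ?d ?k - measure_pmf.expectation ?d' h\<bar>
      \<le> \<gamma> * (2 * B * measure_pmf.expectation ?d (\<lambda>x. tv_dist (P (fst x) (snd x)) (P' (fst x) (snd x))) + S)"
    using \<gamma>(1) by (rule mult_left_mono)
  \<comment> \<open>Both processes restart from the same \<open>p0\<close> with the same weight, so
    these contributions cancel and a factor \<gamma> remains.\<close>
  moreover have "measure_pmf.expectation ?q g - measure_pmf.expectation ?d' f
      = \<gamma> * (measure_pmf.expectation ?d ?k - measure_pmf.expectation ?d' h)"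
    unfolding occupancy_expectation[OF \<gamma> f, of p0 P' \<pi>'] g_def[symmetric]
      state_occupancy_expectation[OF \<gamma> g] h_def
    by (simp add: right_diff_distrib)
  then have "\<bar>measure_pmf.expectation ?q g - measure_pmf.expectation ?d' f\<bar>
      = \<gamma> * \<bar>measure_pmf.expectation ?d ?k - measure_pmf.expectation ?d' h\<bar>"
    using \<gamma>(1) by (simp add: abs_mult)
  ultimately show ?thesis
    using policy by (simp add: algebra_simps)
qed

lemma occupancy_diff_le:
  fixes f :: "'s \<times> 'a \<Rightarrow> real"
  assumes \<gamma>: "0 \<le> \<gamma>" "\<gamma> < 1" and f: "\<And>x. \<bar>f x\<bar> \<le> B"
  shows "\<bar>measure_pmf.expectation (occupancy p0 P \<gamma> \<pi>) f
      - measure_pmf.expectation (occupancy p0 P' \<gamma> \<pi>') f\<bar>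
    \<le> 2 * B * (measure_pmf.expectation (occupancy p0 P \<gamma> \<pi>) (\<lambda>x. tv_dist (\<pi> (fst x)) (\<pi>' (fst x)))
        + \<gamma> * measure_pmf.expectation (occupancy p0 P \<gamma> \<pi>)
            (\<lambda>x. tv_dist (P (fst x) (snd x)) (P' (fst x) (snd x)))) / (1 - \<gamma>)"
    (is "?D f \<le> ?c / (1 - \<gamma>)")
proof -
  \<comment> \<open>The supremum runs over the whole ball of test functions because one step
    replaces \<open>f\<close> by a different function. It is finite, each difference being at most 2
    B, so the inequality for \<open>S\<close> can be solved.\<close>
  define S where "S = (SUP h \<in> {h. \<forall>x. \<bar>h x\<bar> \<le> B}. ?D h)"
  have "?D h \<le> 2 * B" if "\<And>x. \<bar>h x\<bar> \<le> B" for h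
    using abs_integral_measure_pmf_le[of h B "occupancy p0 P \<gamma> \<pi>"]
      abs_integral_measure_pmf_le[of h B "occupancy p0 P' \<gamma> \<pi>'"] that by fastforce
  then have bdd: "bdd_above (?D ` {h. \<forall>x. \<bar>h x\<bar> \<le> B})"
    by (intro bdd_aboveI2[of _ _ "2 * B"]) auto
  have S: "?D h \<le> S" if "\<And>x. \<bar>h x\<bar> \<le> B" for h
    unfolding S_def using that by (intro cSUP_upper[OF _ bdd]) auto
  have "S \<le> ?c + \<gamma> * S"
    unfolding S_def using f
    by (intro cSUP_least, blast) (unfold S_def[symmetric], rule occupancy_diff_step[OF \<gamma> _ S], auto)
  then have "S \<le> ?c / (1 - \<gamma>)"
    using \<gamma> by (simp add: pos_le_divide_eq algebra_simps)
  then show ?thesis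
    using S[of f, OF f] by linarith
qed

section \<open>The performance bound\<close>

text \<open>One factor 1 / (1 - \<gamma>) undoes the normalisation of the occupancy, the other comes
  from solving the fixed-point inequality. Errors are averaged over the visitation of the first
  process.\<close>

lemma expected_return_diff_le:
  assumes \<gamma>: "0 \<le> \<gamma>" "\<gamma> < 1" and r: "\<And>s a. \<bar>r s a\<bar> \<le> B"
  shows "\<bar>expected_return p0 r P \<gamma> \<pi> - expected_return p0 r P' \<gamma> \<pi>'\<bar>
    \<le> 2 * B / (1 - \<gamma>) *
      ((visitation_expectation p0 P \<gamma> \<pi> (\<lambda>s a. tv_dist (\<pi> s) (\<pi>' s))
        + \<gamma> * visitation_expectation p0 P \<gamma> \<pi> (\<lambda>s a. tv_dist (P s a) (P' s a))) / (1 - \<gamma>))"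
proof -
  let ?c = "visitation_expectation p0 P \<gamma> \<pi> (\<lambda>s a. tv_dist (\<pi> s) (\<pi>' s))
        + \<gamma> * visitation_expectation p0 P \<gamma> \<pi> (\<lambda>s a. tv_dist (P s a) (P' s a))"
  let ?D = "\<bar>measure_pmf.expectation (occupancy p0 P \<gamma> \<pi>) (\<lambda>x. r (fst x) (snd x))
      - measure_pmf.expectation (occupancy p0 P' \<gamma> \<pi>') (\<lambda>x. r (fst x) (snd x))\<bar>"
  have "?D \<le> 2 * B * ?c / (1 - \<gamma>)"
    using occupancy_diff_le[OF \<gamma>, of "\<lambda>x. r (fst x) (snd x)" B p0 P \<pi> P' \<pi>'] r
    by (simp add: visitation_expectation_eq[OF \<gamma> abs_tv_dist_le_1])
  then have "?D / (1 - \<gamma>) \<le> 2 * B * ?c / (1 - \<gamma>) / (1 - \<gamma>)"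
    using \<gamma> by (intro divide_right_mono) auto
  moreover have "\<bar>expected_return p0 r P \<gamma> \<pi> - expected_return p0 r P' \<gamma> \<pi>'\<bar> = ?D / (1 - \<gamma>)"
    using \<gamma> by (simp add: expected_return_eq_occupancy[OF \<gamma> r] diff_divide_distrib[symmetric])
  ultimately show ?thesis
    by (simp add: mult_ac)
qed

text \<open>Compare termwise in time: each expected reward lies between 0 and \<open>B\<close>, and
  the weights \<gamma>^t - \<gamma>'^t are nonnegative with a closed-form sum.\<close>

lemma expected_return_discount_diff:
  assumes \<gamma>: "0 \<le> \<gamma>'" "\<gamma>' \<le> \<gamma>" "\<gamma> < 1" and r: "\<And>s a. r s a \<in> {0..B}"
  shows "\<bar>expected_return p0 r P \<gamma> \<pi> - expected_return p0 r P \<gamma>' \<pi>\<bar>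
    \<le> B / (1 - \<gamma>') * ((\<gamma> - \<gamma>') / (1 - \<gamma>))"
proof -
  let ?E = "\<lambda>t. measure_pmf.expectation (state_action_law p0 P \<pi> t) (\<lambda>x. r (fst x) (snd x))"
  have r': "\<bar>r s a\<bar> \<le> B" for s a
    using r[of s a] by simp
  have E: "0 \<le> ?E t" "?E t \<le> B" for t
    using r abs_integral_measure_pmf_le[of "\<lambda>x. r (fst x) (snd x)" B] r'
    by (auto simp: abs_le_iff intro!: integral_nonneg)
  have pow: "\<gamma>' ^ t \<le> \<gamma> ^ t" for t
    using \<gamma> by (intro power_mono) auto
  have sums: "(\<lambda>t. (\<gamma> ^ t - \<gamma>' ^ t) * ?E t) sums
      (expected_return p0 r P \<gamma> \<pi> - expected_return p0 r P \<gamma>' \<pi>)"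
    unfolding left_diff_distrib
    using \<gamma> by (intro sums_diff expected_return_sums[OF _ _ r']) auto
  have geo: "(\<lambda>t. (\<gamma> ^ t - \<gamma>' ^ t) * B) sums ((1 / (1 - \<gamma>) - 1 / (1 - \<gamma>')) * B)"
    using \<gamma> by (intro sums_mult2 sums_diff geometric_sums) auto
  have "0 \<le> expected_return p0 r P \<gamma> \<pi> - expected_return p0 r P \<gamma>' \<pi>"
    by (rule sums_le[OF _ sums_zero sums]) (use E pow in auto)
  moreover have "expected_return p0 r P \<gamma> \<pi> - expected_return p0 r P \<gamma>' \<pi>
      \<le> (1 / (1 - \<gamma>) - 1 / (1 - \<gamma>')) * B"
    by (rule sums_le[OF _ sums geo]) (use E pow in \<open>auto intro!: mult_left_mono\<close>)
  moreover have "(1 / (1 - \<gamma>) - 1 / (1 - \<gamma>')) * B = B / (1 - \<gamma>') * ((\<gamma> - \<gamma>') / (1 - \<gamma>))"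
    using \<gamma> by (simp add: field_simps)
  ultimately show ?thesis
    by simp
qed

theorem theorem1:
  fixes p0 :: "'s::countable pmf"
    and P Phat :: "'s \<Rightarrow> 'a::countable \<Rightarrow> 's pmf"
    and \<pi> \<pi>E :: "'s \<Rightarrow> 'a pmf"
    and r :: "'s \<Rightarrow> 'a \<Rightarrow> real"
    and Rmax \<gamma> \<gamma>hat :: real
  assumes reward: "\<And>s a. r s a \<in> {0..Rmax}"
    and \<gamma>: "\<gamma> \<in> {0..<1}"
    and \<gamma>hat: "\<gamma>hat \<in> {0..<1}"
    and le: "\<gamma>hat \<le> \<gamma>"
  shows
    "let \<epsilon>P = visitation_expectation p0 Phat \<gamma>hat \<pi> (\<lambda>s a. tv_dist (Phat s a) (P s a))
             + visitation_expectation p0 Phat \<gamma>hat \<pi>E (\<lambda>s a. tv_dist (Phat s a) (P s a));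
         \<epsilon>\<pi> = visitation_expectation p0 Phat \<gamma>hat \<pi> (\<lambda>s a. tv_dist (\<pi> s) (\<pi>E s))
     in \<bar>expected_return p0 r P \<gamma> \<pi> - expected_return p0 r P \<gamma> \<pi>E\<bar>
        \<le> 2 * Rmax / (1 - \<gamma>hat) *
          ((\<gamma> - \<gamma>hat) / (1 - \<gamma>) + \<gamma>hat * \<epsilon>P / (1 - \<gamma>hat) + \<epsilon>\<pi> / (1 - \<gamma>hat))"
proof -
  let ?J = "expected_return p0 r" and ?V = "visitation_expectation p0 Phat \<gamma>hat"
  let ?P = "\<lambda>s a. tv_dist (Phat s a) (P s a)" and ?\<pi> = "\<lambda>s a. tv_dist (\<pi> s) (\<pi>E s)"
  let ?K = "2 * Rmax / (1 - \<gamma>hat)"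
  have g: "0 \<le> \<gamma>hat" "\<gamma>hat < 1" "\<gamma> < 1"
    using \<gamma> \<gamma>hat by auto
  have r: "\<bar>r s a\<bar> \<le> Rmax" for s a
    using reward[of s a] by simp
  have zero: "visitation_expectation p0 Q \<gamma>hat \<rho> (\<lambda>s a. 0) = 0" for Q and \<rho> :: "'s \<Rightarrow> 'a pmf"
    by (simp add: visitation_expectation_def split_def)
  \<comment> \<open>\<open>Phat\<close> takes the first place so that every error is averaged under
    the estimated dynamics. Below, a shared policy or shared dynamics makes one of the two error
    terms vanish.\<close>
  note sim = expected_return_diff_le[of \<gamma>hat r Rmax p0 Phat, OF g(1,2) r]
  have dynamics: "\<bar>?J Phat \<gamma>hat \<rho> - ?J P \<gamma>hat \<rho>\<bar> \<le> ?K * (\<gamma>hat * ?V \<rho> ?P / (1 - \<gamma>hat))" for \<rho>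
    using sim[where \<pi>=\<rho> and P'=P and \<pi>'=\<rho>] by (simp only: tv_dist_self zero add_0)
  have policy: "\<bar>?J Phat \<gamma>hat \<pi> - ?J Phat \<gamma>hat \<pi>E\<bar> \<le> ?K * (?V \<pi> ?\<pi> / (1 - \<gamma>hat))"
    using sim[where \<pi>=\<pi> and P'=Phat and \<pi>'=\<pi>E] by (simp only: tv_dist_self zero mult_zero_right add_0_right)
  have discount: "\<bar>?J P \<gamma> \<rho> - ?J P \<gamma>hat \<rho>\<bar> \<le> Rmax / (1 - \<gamma>hat) * ((\<gamma> - \<gamma>hat) / (1 - \<gamma>))" for \<rho>
    by (rule expected_return_discount_diff[OF g(1) le g(3) reward])
  \<comment> \<open>The bound splits along a chain of five comparisons: two changes of discount,
    which together use up the factor 2, two changes of dynamics and one change of policy.\<close>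
  have "?K * ((\<gamma> - \<gamma>hat) / (1 - \<gamma>) + \<gamma>hat * (?V \<pi> ?P + ?V \<pi>E ?P) / (1 - \<gamma>hat)
        + ?V \<pi> ?\<pi> / (1 - \<gamma>hat))
      = 2 * (Rmax / (1 - \<gamma>hat) * ((\<gamma> - \<gamma>hat) / (1 - \<gamma>)))
        + ?K * (\<gamma>hat * ?V \<pi> ?P / (1 - \<gamma>hat)) + ?K * (\<gamma>hat * ?V \<pi>E ?P / (1 - \<gamma>hat))
        + ?K * (?V \<pi> ?\<pi> / (1 - \<gamma>hat))"
    by (simp add: distrib_left add_divide_distrib)
  then show ?thesis
    unfolding Let_def
    using dynamics[of \<pi>] dynamics[of \<pi>E] policy discount[of \<pi>] discount[of \<pi>E] by linarith
qed

end
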